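(* Let $(\zeta^{(k)})_{k\in\mathbb{N}}$ be a sequence of pairwise distinct elements whose set of members is a dense subset of the unit sphere of $\ell^2$, and let $B:\ell^1\to\ell^2$ be the Mazur-type operator $Bx=\sum_{k=1}^\infty x_k\,\zeta^{(k)}$. For $y^\delta\in\ell^2$ and $\alpha\geq 0$ consider the $\ell^1$-Tikhonov functional $$T_\alpha^\delta(x)=\tfrac12\,\|Bx-y^\delta\|_{\ell^2}^2+\alpha\,\|x\|_{\ell^1},\qquad x\in\ell^1.$$ Then $T_\alpha^\delta$ has minimizers over $\ell^1$ if and only if $y^\delta=\lambda\,\zeta^{(k)}$ for some $\lambda\in\mathbb{R}$ and some $k\in\mathbb{N}$. For such $y^\delta=\lambda\,\zeta^{(k)}$ there is exactly one minimizer if $\zeta^{(l)}\neq-\zeta^{(k)}$ for all $l\in\mathbb{N}$, $l\neq k$. The minimizer attains the form $$x_\alpha^\delta=\begin{cases}0,&\text{if }\lambda\in[-\alpha,\alpha],\\(\lambda-\alpha)\,e^{(k)},&\text{if }\lambda>\alpha,\\(\lambda+\alpha)\,e^{(k)},&\text{if }\lambda<-\alpha.\end{cases}$$ If $\zeta^{(k)}=-\zeta^{(l)}$ for some $l$, then for each $$\gamma\in\begin{cases}(\alpha-\lambda,0),&\text{if }\lambda>\alpha,\\(0,-\alpha-\lambda),&\text{if }\lambda<-\alpha\end{cases}$$ there is an additional minimizer of the form $$x_\alpha^\delta=\begin{cases}(\gamma+\lambda-\alpha)\,e^{(k)}+\gamma\,e^{(l)},&\text{if }\lambda>\alpha,\\(\gamma+\lambda+\alpha)\,e^{(k)}+\gamma\,e^{(l)},&\text{if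 }\lambda<-\alpha.\end{cases}$$
   Context: The spaces $\ell^1$ and $\ell^2$ are the real spaces of absolutely summable and square-summable sequences indexed by $\mathbb{N}=\{1,2,\dots\}$, with their usual norms. For $k\in\mathbb{N}$, $e^{(k)}=(0,\ldots,0,1,0,\ldots)$ denotes the sequence with $1$ at position $k$ and zeros elsewhere. Mazur-type operator: for a separable Banach space $Y$ and a sequence $(\zeta^{(k)})_{k\in\mathbb{N}}$ with $\zeta^{(k)}\neq\zeta^{(l)}$ for $k\neq l$ whose members form a countable dense subset of the unit sphere of $Y$, the associated Mazur-type operator is the bounded linear operator $\ell^1\to Y$, $x=(x_1,x_2,\ldots)\mapsto\sum_{k=1}^\infty x_k\,\zeta^{(k)}$; it maps $\ell^1$ onto $Y$. Here $Y=\ell^2$.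
   Formalization: As printed the equivalence fails for α=0 (B is onto) and for α≥‖y‖>0 with y off the lines (0 minimizes); "minimizers exist ⇒ y=λζ^(k)" is proved for 0<α<‖y‖, and when minimizers exist for all α≥0. Uniqueness, false at α=0, is proved for α>0. *)

theory Defs
  imports "HOL-Analysis.Analysis"
begin

text \<open>
  Sequences are indexed by the type \<^typ>\<open>nat\<close>, so position \<open>k\<close> here is position \<open>k + 1\<close>
  when sequences are indexed from one.
\<close>

typedef ell1 = "{x :: nat \<Rightarrow> real. summable (\<lambda>n. \<bar>x n\<bar>)}"
  morphisms nth1 Abs_ell1
  by (rule exI[of _ "\<lambda>_. 0"]) simp

typedef ell2 = "{x :: nat \<Rightarrow> real. summable (\<lambda>n. (x n)\<^sup>2)}"
  morphisms nth2 Abs_ell2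
  by (rule exI[of _ "\<lambda>_. 0"]) simp

setup_lifting type_definition_ell1
setup_lifting type_definition_ell2

subsection \<open>The normed space of absolutely summable sequences\<close>

lemma summable_abs_add:
  fixes x y :: "nat \<Rightarrow> real"
  assumes "summable (\<lambda>n. \<bar>x n\<bar>)" "summable (\<lambda>n. \<bar>y n\<bar>)"
  shows "summable (\<lambda>n. \<bar>x n + y n\<bar>)"
  by (rule summable_comparison_test'[OF summable_add[OF assms], of 0]) simp

instantiation ell1 :: real_normed_vector
begin

lift_definition zero_ell1 :: ell1 is "\<lambda>_. 0" by simp

lift_definition plus_ell1 :: "ell1 \<Rightarrow> ell1 \<Rightarrow> ell1" is "\<lambda>x y n. x n + y n"
  by (rule summable_abs_add)

lift_definition uminus_ell1 :: "ell1 \<Rightarrow> ell1" is "\<lambda>x n. - x n" by simp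

lift_definition minus_ell1 :: "ell1 \<Rightarrow> ell1 \<Rightarrow> ell1" is "\<lambda>x y n. x n - y n"
  subgoal for x y using summable_abs_add[of x "\<lambda>n. - y n"] by simp
  done

lift_definition scaleR_ell1 :: "real \<Rightarrow> ell1 \<Rightarrow> ell1" is "\<lambda>r x n. r * x n"
  by (simp add: abs_mult summable_mult)

lift_definition norm_ell1 :: "ell1 \<Rightarrow> real" is "\<lambda>x. \<Sum>n. \<bar>x n\<bar>" .

definition dist_ell1 :: "ell1 \<Rightarrow> ell1 \<Rightarrow> real" where "dist_ell1 x y = norm (x - y)"

definition sgn_ell1 :: "ell1 \<Rightarrow> ell1" where "sgn_ell1 x = inverse (norm x) *\<^sub>R x"

definition uniformity_ell1 :: "(ell1 \<times> ell1) filter"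
  where "uniformity_ell1 = (INF e\<in>{0 <..}. principal {(x, y). dist x y < e})"

definition open_ell1 :: "ell1 set \<Rightarrow> bool"
  where "open_ell1 U \<longleftrightarrow> (\<forall>x\<in>U. \<forall>\<^sub>F (x', y) in uniformity. x' = x \<longrightarrow> y \<in> U)"

instance
proof
  fix a b :: real and x y z :: ell1
  show "x + y + z = x + (y + z)" by transfer (simp add: add.assoc)
  show "x + y = y + x" by transfer (simp add: add.commute)
  show "0 + x = x" by transfer simp
  show "- x + x = 0" by transfer simp
  show "x - y = x + - y" by transfer simp
  show "a *\<^sub>R (x + y) = a *\<^sub>R x + a *\<^sub>R y" "(a + b) *\<^sub>R x = a *\<^sub>R x + b *\<^sub>R x"
    by (transfer; simp add: algebra_simps)+
  show "a *\<^sub>R b *\<^sub>R x = (a * b) *\<^sub>R x" "1 *\<^sub>R x = x"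
    by (transfer; simp add: algebra_simps)+
  show "dist x y = norm (x - y)" by (rule dist_ell1_def)
  show "sgn x = inverse (norm x) *\<^sub>R x" by (rule sgn_ell1_def)
  show "uniformity = (INF e\<in>{0 <..}. principal {(x :: ell1, y). dist x y < e})"
    by (rule uniformity_ell1_def)
  fix U :: "ell1 set"
  show "open U \<longleftrightarrow> (\<forall>x\<in>U. \<forall>\<^sub>F (x', y) in uniformity. x' = x \<longrightarrow> y \<in> U)"
    by (rule open_ell1_def)
next
  fix a :: real and x y :: ell1
  show "norm x = 0 \<longleftrightarrow> x = 0"
    by transfer (auto simp: suminf_eq_zero_iff fun_eq_iff)
  show "norm (a *\<^sub>R x) = \<bar>a\<bar> * norm x"
    by transfer (simp add: abs_mult suminf_mult)
  show "norm (x + y) \<le> norm x + norm y"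
  proof transfer
    fix x y :: "nat \<Rightarrow> real"
    assume *: "summable (\<lambda>n. \<bar>x n\<bar>)" "summable (\<lambda>n. \<bar>y n\<bar>)"
    have "summable (\<lambda>n. \<bar>x n + y n\<bar>)"
      by (rule summable_abs_add[OF *])
    then have "(\<Sum>n. \<bar>x n + y n\<bar>) \<le> (\<Sum>n. \<bar>x n\<bar> + \<bar>y n\<bar>)"
      by (rule suminf_le[OF abs_triangle_ineq _ summable_add[OF *]])
    also have "\<dots> = (\<Sum>n. \<bar>x n\<bar>) + (\<Sum>n. \<bar>y n\<bar>)"
      by (rule suminf_add[OF *, symmetric])
    finally show "(\<Sum>n. \<bar>x n + y n\<bar>) \<le> (\<Sum>n. \<bar>x n\<bar>) + (\<Sum>n. \<bar>y n\<bar>)" .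
  qed
qed

end

subsection \<open>The Hilbert space of square-summable sequences\<close>

lemma summable_mult_of_squares:
  fixes x y :: "nat \<Rightarrow> real"
  assumes "summable (\<lambda>n. (x n)\<^sup>2)" "summable (\<lambda>n. (y n)\<^sup>2)"
  shows "summable (\<lambda>n. x n * y n)"
proof (rule summable_comparison_test'[OF summable_add[OF assms], of 0])
  fix n
  have "2 * (x n * y n) \<le> (x n)\<^sup>2 + (y n)\<^sup>2"
    using sum_squares_bound[of "x n" "y n"] by simp
  moreover have "- 2 * (x n * y n) \<le> (x n)\<^sup>2 + (y n)\<^sup>2"
    using sum_squares_bound[of "- x n" "y n"] by simp
  moreover have "0 \<le> (x n)\<^sup>2 + (y n)\<^sup>2" by simp
  ultimately show "norm (x n * y n) \<le> (x n)\<^sup>2 + (y n)\<^sup>2"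
    unfolding real_norm_def by linarith
qed

lemma summable_square_add:
  fixes x y :: "nat \<Rightarrow> real"
  assumes "summable (\<lambda>n. (x n)\<^sup>2)" "summable (\<lambda>n. (y n)\<^sup>2)"
  shows "summable (\<lambda>n. (x n + y n)\<^sup>2)"
  using summable_add[OF summable_add[OF assms] summable_mult[OF summable_mult_of_squares[OF assms], of 2]]
  by (simp add: power2_sum mult.assoc)

instantiation ell2 :: real_inner
begin

lift_definition zero_ell2 :: ell2 is "\<lambda>_. 0" by simp

lift_definition plus_ell2 :: "ell2 \<Rightarrow> ell2 \<Rightarrow> ell2" is "\<lambda>x y n. x n + y n"
  by (rule summable_square_add)

lift_definition uminus_ell2 :: "ell2 \<Rightarrow> ell2" is "\<lambda>x n. - x n" by simp

lift_definition minus_ell2 :: "ell2 \<Rightarrow> ell2 \<Rightarrow> ell2" is "\<lambda>x y n. x n - y n"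
  subgoal for x y
    using summable_square_add[of x "\<lambda>n. - y n"] by (simp only: power2_minus add_uminus_conv_diff)
  done

lift_definition scaleR_ell2 :: "real \<Rightarrow> ell2 \<Rightarrow> ell2" is "\<lambda>r x n. r * x n"
  by (simp only: power_mult_distrib) (rule summable_mult)

lift_definition inner_ell2 :: "ell2 \<Rightarrow> ell2 \<Rightarrow> real" is "\<lambda>x y. \<Sum>n. x n * y n" .

lift_definition norm_ell2 :: "ell2 \<Rightarrow> real" is "\<lambda>x. sqrt (\<Sum>n. (x n)\<^sup>2)" .

definition dist_ell2 :: "ell2 \<Rightarrow> ell2 \<Rightarrow> real" where "dist_ell2 x y = norm (x - y)"

definition sgn_ell2 :: "ell2 \<Rightarrow> ell2" where "sgn_ell2 x = inverse (norm x) *\<^sub>R x"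

definition uniformity_ell2 :: "(ell2 \<times> ell2) filter"
  where "uniformity_ell2 = (INF e\<in>{0 <..}. principal {(x, y). dist x y < e})"

definition open_ell2 :: "ell2 set \<Rightarrow> bool"
  where "open_ell2 U \<longleftrightarrow> (\<forall>x\<in>U. \<forall>\<^sub>F (x', y) in uniformity. x' = x \<longrightarrow> y \<in> U)"

instance
proof
  fix a b :: real and x y z :: ell2
  show "x + y + z = x + (y + z)" by transfer (simp add: add.assoc)
  show "x + y = y + x" by transfer (simp add: add.commute)
  show "0 + x = x" by transfer simp
  show "- x + x = 0" by transfer simp
  show "x - y = x + - y" by transfer simp
  show "a *\<^sub>R (x + y) = a *\<^sub>R x + a *\<^sub>R y" "(a + b) *\<^sub>R x = a *\<^sub>R x + b *\<^sub>R x"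
    by (transfer; simp add: algebra_simps)+
  show "a *\<^sub>R b *\<^sub>R x = (a * b) *\<^sub>R x" "1 *\<^sub>R x = x"
    by (transfer; simp add: algebra_simps)+
  show "dist x y = norm (x - y)" by (rule dist_ell2_def)
  show "sgn x = inverse (norm x) *\<^sub>R x" by (rule sgn_ell2_def)
  show "uniformity = (INF e\<in>{0 <..}. principal {(x :: ell2, y). dist x y < e})"
    by (rule uniformity_ell2_def)
  fix U :: "ell2 set"
  show "open U \<longleftrightarrow> (\<forall>x\<in>U. \<forall>\<^sub>F (x', y) in uniformity. x' = x \<longrightarrow> y \<in> U)"
    by (rule open_ell2_def)
next
  fix a :: real and x y z :: ell2
  show "inner x y = inner y x" by transfer (simp add: mult.commute)
  show "inner (x + y) z = inner x z + inner y z"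
    by transfer (simp only: distrib_right, rule suminf_add[symmetric]; rule summable_mult_of_squares)
  show "inner (a *\<^sub>R x) y = a * inner x y"
    by transfer (simp add: mult.assoc suminf_mult summable_mult_of_squares)
  show "0 \<le> inner x x"
    by transfer (simp only: power2_eq_square[symmetric] suminf_nonneg zero_le_power2)
  show "inner x x = 0 \<longleftrightarrow> x = 0"
  proof transfer
    fix x :: "nat \<Rightarrow> real"
    assume "summable (\<lambda>n. (x n)\<^sup>2)"
    then show "(\<Sum>n. x n * x n) = 0 \<longleftrightarrow> x = (\<lambda>_. 0)"
      unfolding power2_eq_square[symmetric]
      by (subst suminf_eq_zero_iff) (auto simp: fun_eq_iff)
  qed
  show "norm x = sqrt (inner x x)"
    by transfer (simp only: power2_eq_square)
qed

end

lemma nth2_minus: "nth2 (x - y) n = nth2 x n - nth2 y n"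
  by (simp add: minus_ell2.rep_eq)

lemma sum_square_le_norm_ell2: "(\<Sum>n<N. (nth2 x n)\<^sup>2) \<le> (norm x)\<^sup>2"
proof -
  have s: "summable (\<lambda>n. (nth2 x n)\<^sup>2)" using nth2[of x] by simp
  have "(norm x)\<^sup>2 = (\<Sum>n. (nth2 x n)\<^sup>2)"
    unfolding norm_ell2.rep_eq
    by (rule real_sqrt_pow2) (rule suminf_nonneg[OF s zero_le_power2])
  moreover have "(\<Sum>n<N. (nth2 x n)\<^sup>2) \<le> (\<Sum>n. (nth2 x n)\<^sup>2)"
    by (rule sum_le_suminf[OF s finite_lessThan zero_le_power2])
  ultimately show ?thesis by (simp only:)
qed

lemma abs_nth2_le_norm: "\<bar>nth2 x n\<bar> \<le> norm x"
proof (rule power2_le_imp_le)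
  have "(nth2 x n)\<^sup>2 \<le> (\<Sum>i<Suc n. (nth2 x i)\<^sup>2)"
    by (rule member_le_sum[of n "{..<Suc n}" "\<lambda>i. (nth2 x i)\<^sup>2"]) simp_all
  also have "\<dots> \<le> (norm x)\<^sup>2" by (rule sum_square_le_norm_ell2)
  finally show "\<bar>nth2 x n\<bar>\<^sup>2 \<le> (norm x)\<^sup>2" by (simp only: power2_abs)
qed (rule norm_ge_zero)

instance ell2 :: banach
proof
  fix X :: "nat \<Rightarrow> ell2"
  assume X: "Cauchy X"
  have "Cauchy (\<lambda>m. nth2 (X m) n)" for n
  proof (rule CauchyI)
    fix e :: real assume "0 < e"
    then obtain M where M: "\<And>m k. m \<ge> M \<Longrightarrow> k \<ge> M \<Longrightarrow> norm (X m - X k) < e"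
      using CauchyD[OF X] by blast
    have "norm (nth2 (X m) n - nth2 (X k) n) < e" if "m \<ge> M" "k \<ge> M" for m k
      using M[OF that] abs_nth2_le_norm[of "X m - X k" n] by (simp add: nth2_minus)
    then show "\<exists>M. \<forall>m\<ge>M. \<forall>k\<ge>M. norm (nth2 (X m) n - nth2 (X k) n) < e" by blast
  qed
  then have "\<forall>n. \<exists>l. (\<lambda>m. nth2 (X m) n) \<longlonglongrightarrow> l"
    by (simp add: Cauchy_convergent_iff convergent_def)
  then obtain l where l: "\<And>n. (\<lambda>m. nth2 (X m) n) \<longlonglongrightarrow> l n" by metis
  have key: "\<exists>M. \<forall>m\<ge>M. \<forall>N. (\<Sum>n<N. (nth2 (X m) n - l n)\<^sup>2) \<le> e\<^sup>2" if "e > 0" for e :: real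
  proof -
    obtain M where M: "\<And>m k. m \<ge> M \<Longrightarrow> k \<ge> M \<Longrightarrow> norm (X m - X k) < e"
      using CauchyD[OF X \<open>e > 0\<close>] by blast
    have "(\<Sum>n<N. (nth2 (X m) n - l n)\<^sup>2) \<le> e\<^sup>2" if "m \<ge> M" for m N
    proof (rule Lim_bounded[where M = M])
      show "(\<lambda>k. \<Sum>n<N. (nth2 (X m) n - nth2 (X k) n)\<^sup>2) \<longlonglongrightarrow> (\<Sum>n<N. (nth2 (X m) n - l n)\<^sup>2)"
        by (intro tendsto_intros l)
      show "\<forall>k\<ge>M. (\<Sum>n<N. (nth2 (X m) n - nth2 (X k) n)\<^sup>2) \<le> e\<^sup>2"
      proof (intro allI impI)
        fix k assume "k \<ge> M"
        have "(\<Sum>n<N. (nth2 (X m) n - nth2 (X k) n)\<^sup>2) \<le> (norm (X m - X k))\<^sup>2"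
          using sum_square_le_norm_ell2[where x = "X m - X k" and N = N] by (simp add: nth2_minus)
        also have "\<dots> \<le> e\<^sup>2"
          using M[OF \<open>m \<ge> M\<close> \<open>k \<ge> M\<close>] by (intro power_mono) auto
        finally show "(\<Sum>n<N. (nth2 (X m) n - nth2 (X k) n)\<^sup>2) \<le> e\<^sup>2" .
      qed
    qed
    then show ?thesis by blast
  qed
  have summ: "summable (\<lambda>n. (nth2 (X m) n - l n)\<^sup>2)"
    if "\<forall>N. (\<Sum>n<N. (nth2 (X m) n - l n)\<^sup>2) \<le> e\<^sup>2" for m and e :: real
    using that by (intro summableI_nonneg_bounded[where x = "e\<^sup>2"]) auto
  obtain M where M: "\<forall>N. (\<Sum>n<N. (nth2 (X M) n - l n)\<^sup>2) \<le> 1\<^sup>2"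
    using key[of 1] by auto
  have "summable (\<lambda>n. (nth2 (X M) n)\<^sup>2)" using nth2[of "X M"] by simp
  moreover have "summable (\<lambda>n. (- (nth2 (X M) n - l n))\<^sup>2)"
    using summ[OF M] by (simp only: power2_minus)
  ultimately have "summable (\<lambda>n. (l n)\<^sup>2)"
    using summable_square_add[of "nth2 (X M)" "\<lambda>n. - (nth2 (X M) n - l n)"] by simp
  then have L: "nth2 (Abs_ell2 l) = l" by (simp add: Abs_ell2_inverse)
  have "X \<longlonglongrightarrow> Abs_ell2 l"
  proof (rule LIMSEQ_I)
    fix r :: real assume "0 < r"
    then obtain M where M: "\<And>m. m \<ge> M \<Longrightarrow> \<forall>N. (\<Sum>n<N. (nth2 (X m) n - l n)\<^sup>2) \<le> (r / 2)\<^sup>2"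
      using key[of "r / 2"] by auto
    have "norm (X m - Abs_ell2 l) < r" if "m \<ge> M" for m
    proof -
      have "(\<Sum>n. (nth2 (X m) n - l n)\<^sup>2) \<le> (r / 2)\<^sup>2"
        using M[OF that] by (intro suminf_le_const summ) auto
      then have "sqrt (\<Sum>n. (nth2 (X m) n - l n)\<^sup>2) \<le> r / 2"
        using \<open>0 < r\<close> real_sqrt_le_mono[of _ "(r / 2)\<^sup>2"] by (metis abs_of_pos half_gt_zero real_sqrt_abs)
      then have "norm (X m - Abs_ell2 l) \<le> r / 2"
        by (simp add: norm_ell2.rep_eq nth2_minus L)
      with \<open>0 < r\<close> show ?thesis by simp
    qed
    then show "\<exists>no. \<forall>n\<ge>no. norm (X n - Abs_ell2 l) < r" by blast
  qed
  then show "convergent X" by (auto simp: convergent_def)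
qed

subsection \<open>Mazur-type operators and the Tikhonov functional\<close>

lift_definition unit1 :: "nat \<Rightarrow> ell1" is "\<lambda>k n. if n = k then 1 else 0"
  subgoal for k by (rule summable_finite[of "{k}"]) auto
  done

text \<open>Countability of the dense set of members is implicit in the index type.\<close>

definition mazur_sequence :: "(nat \<Rightarrow> 'y::banach) \<Rightarrow> bool" where
  "mazur_sequence \<zeta> \<longleftrightarrow>
     inj \<zeta> \<and> range \<zeta> \<subseteq> sphere 0 1 \<and> sphere 0 1 \<subseteq> closure (range \<zeta>)"

definition mazur_operator :: "(nat \<Rightarrow> 'y::banach) \<Rightarrow> ell1 \<Rightarrow> 'y" where
  "mazur_operator \<zeta> x = (\<Sum>k. nth1 x k *\<^sub>R \<zeta> k)"

lemma mazur_operator_sums: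
  assumes "mazur_sequence \<zeta>"
  shows "(\<lambda>k. nth1 x k *\<^sub>R \<zeta> k) sums mazur_operator \<zeta> x"
proof -
  have "\<zeta> k \<in> sphere 0 1" for k
    using assms unfolding mazur_sequence_def by blast
  then have "norm (\<zeta> k) = 1" for k by simp
  then have "summable (\<lambda>k. norm (nth1 x k *\<^sub>R \<zeta> k))"
    using nth1[of x] by simp
  then show ?thesis
    unfolding mazur_operator_def by (rule summable_sums[OF summable_norm_cancel])
qed

definition tikhonov :: "(ell1 \<Rightarrow> ell2) \<Rightarrow> ell2 \<Rightarrow> real \<Rightarrow> ell1 \<Rightarrow> real" where
  "tikhonov B y \<alpha> x = 1 / 2 * (norm (B x - y))\<^sup>2 + \<alpha> * norm x"

abbreviation is_minimizer :: "(ell1 \<Rightarrow> real) \<Rightarrow> ell1 \<Rightarrow> bool" where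
  "is_minimizer T x \<equiv> is_arg_min T (\<lambda>_. True) x"

text \<open>For \<open>\<alpha> \<ge> 0\<close> the last case is \<open>lam < - \<alpha>\<close>.\<close>

definition shrunk_unit :: "real \<Rightarrow> real \<Rightarrow> nat \<Rightarrow> ell1" where
  "shrunk_unit \<alpha> lam k =
     (if lam \<in> {-\<alpha>..\<alpha>} then 0
      else if lam > \<alpha> then (lam - \<alpha>) *\<^sub>R unit1 k
      else (lam + \<alpha>) *\<^sub>R unit1 k)"

end

theory Submission
  imports Defs
begin

text \<open>
  Write \<open>y = s *\<^sub>R u\<close> with a unit vector \<open>u\<close>, and let \<open>B\<close> be the Mazur-type operator.
  Completing the square around \<open>(s - \<alpha>) *\<^sub>R u\<close> instead of \<open>y\<close> gives the identity
  \<open>T x = \<alpha> * (s - \<alpha>) + \<alpha>\<^sup>2 / 2 + norm (B x - (s - \<alpha>) *\<^sub>R u)\<^sup>2 / 2 + \<alpha> * (norm x - inner (B x) u)\<close>,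
  in which both \<open>x\<close>-dependent summands are nonnegative: the last one because
  \<open>norm x - inner (B x) u\<close> is the sum of \<open>\<bar>x\<^sub>k\<bar> - x\<^sub>k * inner (\<zeta> k) u \<ge> 0\<close>.

  Let \<open>0 \<le> \<alpha> \<le> s\<close>. Since the \<open>\<zeta> k\<close> are dense in the sphere, vectors
  \<open>(s - \<alpha>) *\<^sub>R unit1 k\<close> with \<open>\<zeta> k\<close> close to \<open>u\<close> make both summands arbitrarily small, so the
  infimum is the constant part, and the minimizers are exactly the points at which both summands
  vanish (\<open>is_minimizer_iff\<close>). If \<open>\<alpha> > 0\<close>, the second summand vanishes only if \<open>x\<close> is supported
  on indices with \<open>\<zeta> k = u\<close> or \<open>\<zeta> k = - u\<close>, positive on the former and negative on the latter
  (\<open>support_of_norm_attaining\<close>). If moreover \<open>\<alpha> < s\<close>, then \<open>B x \<noteq> 0\<close> forces the support to be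
  nonempty, so a minimizer can exist only if \<open>u\<close> is, up to sign, a member of the sequence;
  in that case the first summand determines \<open>x\<close> up to the freedom of splitting the mass between
  \<open>u\<close> and \<open>- u\<close>, when both are members. For \<open>\<bar>s\<bar> \<le> \<alpha>\<close> the penalty dominates the linear
  part of the functional and \<open>0\<close> is a minimizer.
\<close>

section \<open>Summable sequences and the Mazur-type operator\<close>

lemma nth1_simps [simp]:
  "nth1 (x + y) j = nth1 x j + nth1 y j"
  "nth1 (r *\<^sub>R x) j = r * nth1 x j"
  "nth1 (unit1 k) j = (if j = k then 1 else 0)"
  "nth1 0 j = 0"
  by (simp_all add: plus_ell1.rep_eq scaleR_ell1.rep_eq unit1.rep_eq zero_ell1.rep_eq)

lemma ell1_eqI: "(\<And>j. nth1 x j = nth1 y j) \<Longrightarrow> x = y"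
  by (metis ext nth1_inject)

lemma norm_ell1_sums: "(\<lambda>k. \<bar>nth1 x k\<bar>) sums norm x"
  using nth1[of x] by (simp add: norm_ell1.rep_eq summable_sums)

lemma norm_unit1 [simp]: "norm (unit1 k) = 1"
proof -
  have "(\<lambda>j. \<bar>nth1 (unit1 k) j\<bar>) = (\<lambda>j. if j = k then 1 else 0)" by auto
  then show ?thesis
    using norm_ell1_sums[of "unit1 k"] sums_single[of k "\<lambda>_. 1::real"] sums_unique2 by metis
qed

lemma norm_unit1_combination:
  assumes "k \<noteq> l"
  shows "norm (a *\<^sub>R unit1 k + b *\<^sub>R unit1 l) = \<bar>a\<bar> + \<bar>b\<bar>"
proof -
  have "(\<lambda>j. \<bar>nth1 (a *\<^sub>R unit1 k + b *\<^sub>R unit1 l) j\<bar>)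
      = (\<lambda>j. (if j = k then \<bar>a\<bar> else 0) + (if j = l then \<bar>b\<bar> else 0))"
    using assms by (auto simp: fun_eq_iff)
  then show ?thesis
    using norm_ell1_sums[of "a *\<^sub>R unit1 k + b *\<^sub>R unit1 l"]
      sums_add[OF sums_single[of k "\<lambda>_. \<bar>a\<bar>"] sums_single[of l "\<lambda>_. \<bar>b\<bar>"]] sums_unique2
    by metis
qed

lemma norm_mazur_sequence:
  assumes "mazur_sequence \<zeta>"
  shows "norm (\<zeta> k) = 1"
proof -
  have "\<zeta> k \<in> sphere 0 1"
    using assms unfolding mazur_sequence_def by blast
  then show ?thesis by simp
qed

lemma mazur_operator_add:
  assumes "mazur_sequence \<zeta>"
  shows "mazur_operator \<zeta> (x + y) = mazur_operator \<zeta> x + mazur_operator \<zeta> y"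
  using sums_add[OF mazur_operator_sums[OF assms, of x] mazur_operator_sums[OF assms, of y]]
    mazur_operator_sums[OF assms, of "x + y"] sums_unique2
  by (simp add: scaleR_left_distrib) blast

lemma mazur_operator_scaleR_unit1 [simp]: "mazur_operator \<zeta> (a *\<^sub>R unit1 k) = a *\<^sub>R \<zeta> k"
proof -
  have "(\<lambda>j. nth1 (a *\<^sub>R unit1 k) j *\<^sub>R \<zeta> j) = (\<lambda>j. if j = k then a *\<^sub>R \<zeta> j else 0)" by auto
  then show ?thesis
    using sums_single[of k "\<lambda>j. a *\<^sub>R \<zeta> j"] by (simp add: mazur_operator_def sums_iff)
qed

lemma mazur_operator_zero [simp]: "mazur_operator \<zeta> 0 = 0"
  by (simp add: mazur_operator_def)

section \<open>Norm-attaining sequences\<close>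

lemma unit_vectors_eqI:
  fixes u v :: "'a::real_inner"
  assumes "norm u = 1" "norm v = 1" "inner u v = 1"
  shows "u = v"
proof -
  have "(norm (u - v))\<^sup>2 = 0"
    using assms by (simp add: power2_norm_eq_inner inner_diff inner_commute norm_eq_1)
  then show ?thesis by simp
qed

context
  fixes \<zeta> :: "nat \<Rightarrow> 'y::{real_inner, banach}"
  assumes mazur: "mazur_sequence \<zeta>"
begin

lemma norm_minus_inner_mazur_operator_sums:
  "(\<lambda>k. \<bar>nth1 x k\<bar> - nth1 x k * inner (\<zeta> k) u) sums (norm x - inner (mazur_operator \<zeta> x) u)"
  using sums_diff[OF norm_ell1_sums[of x]
      bounded_linear.sums[OF bounded_linear_inner_left mazur_operator_sums[OF mazur, of x], of u]]
  by simp

lemma coordinate_times_inner_le: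
  assumes "norm u = 1"
  shows "nth1 x k * inner (\<zeta> k) u \<le> \<bar>nth1 x k\<bar>"
proof -
  have "\<bar>inner (\<zeta> k) u\<bar> \<le> 1"
    using Cauchy_Schwarz_ineq2[of "\<zeta> k" u] assms norm_mazur_sequence[OF mazur] by simp
  then have "\<bar>nth1 x k * inner (\<zeta> k) u\<bar> \<le> \<bar>nth1 x k\<bar>"
    by (simp add: abs_mult mult_left_le)
  then show ?thesis by linarith
qed

lemma inner_mazur_operator_le_norm:
  assumes "norm u = 1"
  shows "inner (mazur_operator \<zeta> x) u \<le> norm x"
  using sums_le[OF _ sums_zero norm_minus_inner_mazur_operator_sums[of x u]]
    coordinate_times_inner_le[OF assms] by simp

text \<open>
  A sum of nonnegative terms vanishes only termwise, and
  \<open>x\<^sub>j * inner (\<zeta> j) u = \<bar>x\<^sub>j\<bar> \<noteq> 0\<close> is the equality case of the Cauchy-Schwarz inequality.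
\<close>

lemma support_of_norm_attaining:
  assumes "norm u = 1" "inner (mazur_operator \<zeta> x) u = norm x" "nth1 x j \<noteq> 0"
  shows "u = sgn (nth1 x j) *\<^sub>R \<zeta> j"
proof -
  let ?d = "\<lambda>k. \<bar>nth1 x k\<bar> - nth1 x k * inner (\<zeta> k) u"
  have "?d sums 0"
    using norm_minus_inner_mazur_operator_sums[of x u] assms(2) by simp
  moreover have "0 \<le> ?d k" for k using coordinate_times_inner_le[OF assms(1)] by simp
  ultimately have "?d j = 0"
    using suminf_eq_zero_iff[of ?d] by (auto simp: sums_iff)
  then have "nth1 x j * inner (\<zeta> j) u = nth1 x j * sgn (nth1 x j)"
    using abs_sgn[of "nth1 x j"] by linarith
  then have "inner (\<zeta> j) u = sgn (nth1 x j)"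
    by (rule mult_left_cancel[OF assms(3), THEN iffD1])
  then have "inner (sgn (nth1 x j) *\<^sub>R \<zeta> j) u = 1"
    using assms(3) by (simp add: sgn_real_def)
  moreover have "norm (sgn (nth1 x j) *\<^sub>R \<zeta> j) = 1"
    using assms(3) norm_mazur_sequence[OF mazur] by (simp add: sgn_real_def)
  ultimately show ?thesis using unit_vectors_eqI assms(1) by metis
qed

end

section \<open>Minimizers of the Tikhonov functional\<close>

lemma tikhonov_decomposition:
  assumes "norm u = 1"
  shows "tikhonov B (s *\<^sub>R u) \<alpha> x = \<alpha> * (s - \<alpha>) + \<alpha>\<^sup>2 / 2
    + (norm (B x - (s - \<alpha>) *\<^sub>R u))\<^sup>2 / 2 + \<alpha> * (norm x - inner (B x) u)"
proof -
  have "inner u u = 1" using assms by (simp add: norm_eq_1)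
  then show ?thesis
    unfolding tikhonov_def power2_norm_eq_inner inner_diff_left inner_diff_right
      inner_scaleR_left inner_scaleR_right inner_commute[of u "B x"]
    by (simp add: power2_eq_square field_simps)
qed

lemma is_minimizer_iff_le: "is_minimizer T x \<longleftrightarrow> (\<forall>z. T x \<le> T z)"
  by (auto simp: is_arg_min_linorder)

context
  fixes \<zeta> :: "nat \<Rightarrow> ell2"
  assumes mazur: "mazur_sequence \<zeta>"
begin

text \<open>
  With \<open>inner (\<zeta> k) u = 1 - norm (\<zeta> k - u)\<^sup>2 / 2\<close>, the value at \<open>(s - \<alpha>) *\<^sub>R unit1 k\<close> exceeds
  the constant part of the decomposition by \<open>s * (s - \<alpha>) / 2 * norm (\<zeta> k - u)\<^sup>2\<close>; density makes
  this arbitrarily small.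
\<close>

lemma minimal_value_le:
  assumes u: "norm u = 1" and "0 \<le> \<alpha>" "\<alpha> \<le> s"
    and min: "is_minimizer (tikhonov (mazur_operator \<zeta>) (s *\<^sub>R u) \<alpha>) x"
  shows "tikhonov (mazur_operator \<zeta>) (s *\<^sub>R u) \<alpha> x \<le> \<alpha> * (s - \<alpha>) + \<alpha>\<^sup>2 / 2"
proof -
  let ?T = "tikhonov (mazur_operator \<zeta>) (s *\<^sub>R u) \<alpha>" and ?m = "\<alpha> * (s - \<alpha>) + \<alpha>\<^sup>2 / 2"
  have value_at: "?T ((s - \<alpha>) *\<^sub>R unit1 k) = ?m + s * (s - \<alpha>) / 2 * (norm (\<zeta> k - u))\<^sup>2" for k
  proof -
    have inner: "inner (\<zeta> k) u = 1 - (norm (\<zeta> k - u))\<^sup>2 / 2"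
      using u norm_mazur_sequence[OF mazur, of k]
      by (simp add: power2_norm_eq_inner inner_diff inner_commute norm_eq_1 diff_divide_distrib)
    have dist: "norm ((s - \<alpha>) *\<^sub>R \<zeta> k - (s - \<alpha>) *\<^sub>R u) = (s - \<alpha>) * norm (\<zeta> k - u)"
      using \<open>\<alpha> \<le> s\<close> by (simp flip: scaleR_right_diff_distrib)
    have norm: "norm ((s - \<alpha>) *\<^sub>R unit1 k) = s - \<alpha>"
      using \<open>\<alpha> \<le> s\<close> by simp
    show ?thesis
      unfolding tikhonov_decomposition[OF u] mazur_operator_scaleR_unit1 dist norm
        inner_scaleR_left inner
      by (simp add: power2_eq_square field_simps)
  qed
  have "u \<in> closure (range \<zeta>)"
    using mazur u by (auto simp: mazur_sequence_def)
  then obtain v where v: "\<And>n. v n \<in> range \<zeta>" and lim: "v \<longlonglongrightarrow> u"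
    by (auto simp: closure_sequential)
  have "?T x \<le> ?m + s * (s - \<alpha>) / 2 * (norm (v n - u))\<^sup>2" for n
  proof -
    obtain k where "v n = \<zeta> k" using v by blast
    then show ?thesis using min value_at[of k] unfolding is_minimizer_iff_le by metis
  qed
  moreover have "(\<lambda>n. ?m + s * (s - \<alpha>) / 2 * (norm (v n - u))\<^sup>2)
      \<longlonglongrightarrow> ?m + s * (s - \<alpha>) / 2 * (norm (u - u))\<^sup>2"
    by (intro tendsto_intros lim)
  ultimately show ?thesis
    by (intro LIMSEQ_le_const) auto
qed

lemma is_minimizer_iff:
  assumes u: "norm u = 1" and "0 \<le> \<alpha>" "\<alpha> \<le> s"
  shows "is_minimizer (tikhonov (mazur_operator \<zeta>) (s *\<^sub>R u) \<alpha>) x \<longleftrightarrow>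
    mazur_operator \<zeta> x = (s - \<alpha>) *\<^sub>R u \<and> \<alpha> * (norm x - inner (mazur_operator \<zeta> x) u) = 0"
    (is "?min x \<longleftrightarrow> ?zero x")
proof -
  let ?B = "mazur_operator \<zeta>"
  have nonneg: "0 \<le> \<alpha> * (norm z - inner (?B z) u)" for z
    using \<open>0 \<le> \<alpha>\<close> inner_mazur_operator_le_norm[OF mazur u, of z] by simp
  show ?thesis
  proof
    assume "?min x"
    from minimal_value_le[OF assms this]
    have "(norm (?B x - (s - \<alpha>) *\<^sub>R u))\<^sup>2 / 2 + \<alpha> * (norm x - inner (?B x) u) \<le> 0"
      unfolding tikhonov_decomposition[OF u] by simp
    with nonneg[of x] show "?zero x"
      by (smt (verit) field_sum_of_halves norm_eq_zero right_minus_eq zero_eq_power2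
          zero_le_power2)
  next
    assume "?zero x"
    then have "(norm (?B x - (s - \<alpha>) *\<^sub>R u))\<^sup>2 / 2 = 0"
      and "\<alpha> * (norm x - inner (?B x) u) = 0"
      by (simp, blast)
    moreover have "0 \<le> (norm (?B z - (s - \<alpha>) *\<^sub>R u))\<^sup>2 / 2" for z by simp
    ultimately show "?min x"
      using nonneg unfolding is_minimizer_iff_le tikhonov_decomposition[OF u] by (smt (verit))
  qed
qed

lemma is_minimizerI:
  assumes u: "norm u = 1" and "0 \<le> \<alpha>" "\<alpha> \<le> s"
    and "mazur_operator \<zeta> x = (s - \<alpha>) *\<^sub>R u" "norm x = s - \<alpha>"
  shows "is_minimizer (tikhonov (mazur_operator \<zeta>) (s *\<^sub>R u) \<alpha>) x"
  unfolding is_minimizer_iff[OF assms(1-3)] using assms by (simp add: norm_eq_1)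

text \<open>
  The operator maps a minimizer to the nonzero vector \<open>(1 - \<alpha> / norm y) *\<^sub>R y\<close>, so the
  minimizer has a nonzero coordinate, whose member of the sequence is then parallel to \<open>y\<close>.
\<close>

lemma multiple_of_member_if_minimizer:
  assumes "0 < \<alpha>" "\<alpha> < norm y"
    and min: "is_minimizer (tikhonov (mazur_operator \<zeta>) y \<alpha>) x"
  shows "\<exists>lam k. y = lam *\<^sub>R \<zeta> k"
proof -
  define u where "u = sgn y"
  have "y \<noteq> 0" using assms(1,2) by auto
  then have u: "norm u = 1" and y: "y = norm y *\<^sub>R u"
    by (simp_all add: u_def norm_sgn sgn_div_norm)
  have "is_minimizer (tikhonov (mazur_operator \<zeta>) (norm y *\<^sub>R u) \<alpha>) x"
    using min y by simp
  then have B: "mazur_operator \<zeta> x = (norm y - \<alpha>) *\<^sub>R u"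
    and att: "inner (mazur_operator \<zeta> x) u = norm x"
    using is_minimizer_iff[OF u, of \<alpha> "norm y" x] assms(1,2) by auto
  have "mazur_operator \<zeta> x \<noteq> 0"
    using B u assms(2) by auto
  then have "x \<noteq> 0" by auto
  then obtain j where "nth1 x j \<noteq> 0" using ell1_eqI[of x 0] by auto
  from support_of_norm_attaining[OF mazur u att this] y
  have "y = (norm y * sgn (nth1 x j)) *\<^sub>R \<zeta> j" by (metis scaleR_scaleR)
  then show ?thesis by blast
qed

text \<open>
  Around \<open>0\<close> the functional grows by \<open>norm (B x)\<^sup>2 / 2 + (\<alpha> * norm x - inner (B x) y)\<close>, and
  the second summand is nonnegative because \<open>norm y \<le> \<alpha>\<close>. If the growth is zero, then \<open>B x = 0\<close>,
  which leaves \<open>\<alpha> * norm x = 0\<close>.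
\<close>

lemma
  assumes "norm y \<le> \<alpha>"
  shows is_minimizer_zero: "is_minimizer (tikhonov (mazur_operator \<zeta>) y \<alpha>) 0"
    and is_minimizer_imp_zero:
      "0 < \<alpha> \<Longrightarrow> is_minimizer (tikhonov (mazur_operator \<zeta>) y \<alpha>) x \<Longrightarrow> x = 0"
proof -
  let ?B = "mazur_operator \<zeta>"
  have growth: "tikhonov ?B y \<alpha> z
      = tikhonov ?B y \<alpha> 0 + (norm (?B z))\<^sup>2 / 2 + (\<alpha> * norm z - inner (?B z) y)" for z
    unfolding tikhonov_def power2_norm_eq_inner
    by (simp add: inner_diff inner_commute field_simps)
  have nonneg: "0 \<le> \<alpha> * norm z - inner (?B z) y" for z
  proof (cases "y = 0")
    case True
    then show ?thesis using assms by simp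
  next
    case False
    then have u: "norm (sgn y) = 1" and y: "y = norm y *\<^sub>R sgn y"
      by (simp_all add: norm_sgn sgn_div_norm)
    have "inner (?B z) y = norm y * inner (?B z) (sgn y)"
      by (subst y) simp
    also have "\<dots> \<le> norm y * norm z"
      by (intro mult_left_mono inner_mazur_operator_le_norm[OF mazur u]) simp
    also have "\<dots> \<le> \<alpha> * norm z"
      using assms by (simp add: mult_right_mono)
    finally show ?thesis by simp
  qed
  show "is_minimizer (tikhonov ?B y \<alpha>) 0"
    unfolding is_minimizer_iff_le
  proof
    fix z
    have "0 \<le> (norm (?B z))\<^sup>2 / 2" by simp
    then show "tikhonov ?B y \<alpha> 0 \<le> tikhonov ?B y \<alpha> z"
      using growth[of z] nonneg[of z] by linarith
  qed
  assume "0 < \<alpha>" "is_minimizer (tikhonov ?B y \<alpha>) x"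
  then have "tikhonov ?B y \<alpha> x \<le> tikhonov ?B y \<alpha> 0"
    unfolding is_minimizer_iff_le by blast
  then have "(norm (?B x))\<^sup>2 / 2 + (\<alpha> * norm x - inner (?B x) y) \<le> 0"
    using growth[of x] by linarith
  moreover have "0 \<le> (norm (?B x))\<^sup>2 / 2" by simp
  ultimately have "(norm (?B x))\<^sup>2 / 2 = 0" and "\<alpha> * norm x - inner (?B x) y = 0"
    using nonneg[of x] by linarith+
  then show "x = 0" using \<open>0 < \<alpha>\<close> by simp
qed

section \<open>Data proportional to a member of the sequence\<close>

lemma shrunk_unit_eq_soft_threshold:
  assumes "0 \<le> \<alpha>"
  shows "shrunk_unit \<alpha> lam k = (sgn lam * max 0 (\<bar>lam\<bar> - \<alpha>)) *\<^sub>R unit1 k"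
  using assms by (auto simp: shrunk_unit_def sgn_real_def max_def)

text \<open>
  The vector \<open>lam *\<^sub>R \<zeta> k\<close> is \<open>\<bar>lam\<bar>\<close> times the unit vector \<open>sgn lam *\<^sub>R \<zeta> k\<close>, so
  both signs of \<open>lam\<close> fall under the previous criteria.
\<close>

lemma is_minimizer_scaled_memberI:
  assumes "0 \<le> \<alpha>" "\<alpha> < \<bar>lam\<bar>"
    and "mazur_operator \<zeta> x = (sgn lam * (\<bar>lam\<bar> - \<alpha>)) *\<^sub>R \<zeta> k" "norm x = \<bar>lam\<bar> - \<alpha>"
  shows "is_minimizer (tikhonov (mazur_operator \<zeta>) (lam *\<^sub>R \<zeta> k) \<alpha>) x"
proof -
  have "norm (sgn lam *\<^sub>R \<zeta> k) = 1"
    using assms(1,2) norm_mazur_sequence[OF mazur] by (auto simp: sgn_real_def)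
  from is_minimizerI[OF this, of \<alpha> "\<bar>lam\<bar>" x] assms show ?thesis
    by (simp add: mult.commute mult_sgn_abs abs_mult_sgn)
qed

lemma is_minimizer_shrunk_unit:
  assumes "0 \<le> \<alpha>"
  shows "is_minimizer (tikhonov (mazur_operator \<zeta>) (lam *\<^sub>R \<zeta> k) \<alpha>) (shrunk_unit \<alpha> lam k)"
proof (cases "\<bar>lam\<bar> \<le> \<alpha>")
  case True
  then show ?thesis
    using is_minimizer_zero[of "lam *\<^sub>R \<zeta> k" \<alpha>] norm_mazur_sequence[OF mazur, of k] assms
    by (simp add: shrunk_unit_eq_soft_threshold)
next
  case False
  then show ?thesis
    using assms by (intro is_minimizer_scaled_memberI)
      (auto simp: shrunk_unit_eq_soft_threshold abs_mult sgn_real_def)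
qed

text \<open>
  For \<open>\<bar>lam\<bar> > \<alpha>\<close>, norm attainment confines the support to indices of members parallel to \<open>\<zeta> k\<close>. Without an
  antipode, injectivity leaves only \<open>k\<close>, and the image under the operator fixes the coordinate.
\<close>

lemma minimizer_eq_shrunk_unit:
  assumes "0 < \<alpha>" and no_antipode: "\<And>l. l \<noteq> k \<Longrightarrow> \<zeta> l \<noteq> - \<zeta> k"
    and min: "is_minimizer (tikhonov (mazur_operator \<zeta>) (lam *\<^sub>R \<zeta> k) \<alpha>) x"
  shows "x = shrunk_unit \<alpha> lam k"
proof (cases "\<bar>lam\<bar> \<le> \<alpha>")
  case True
  then show ?thesis
    using is_minimizer_imp_zero[of "lam *\<^sub>R \<zeta> k" \<alpha> x] norm_mazur_sequence[OF mazur, of k]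
      assms(1) min
    by (simp add: shrunk_unit_eq_soft_threshold)
next
  case False
  define u where "u = sgn lam *\<^sub>R \<zeta> k"
  have sgn_lam: "sgn lam = 1 \<or> sgn lam = - 1"
    using False assms(1) by (auto simp: sgn_real_def)
  have nz: "\<zeta> k \<noteq> 0" using norm_mazur_sequence[OF mazur, of k] by auto
  have u: "norm u = 1"
    using sgn_lam norm_mazur_sequence[OF mazur] by (auto simp: u_def)
  have "is_minimizer (tikhonov (mazur_operator \<zeta>) (\<bar>lam\<bar> *\<^sub>R u) \<alpha>) x"
    using min by (simp add: u_def abs_mult_sgn)
  then have B: "mazur_operator \<zeta> x = (\<bar>lam\<bar> - \<alpha>) *\<^sub>R u"
    and att: "inner (mazur_operator \<zeta> x) u = norm x"
    using is_minimizer_iff[OF u, of \<alpha> "\<bar>lam\<bar>" x] assms(1) False by auto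
  have "nth1 x j = 0" if "j \<noteq> k" for j
  proof (rule ccontr)
    assume j: "nth1 x j \<noteq> 0"
    from support_of_norm_attaining[OF mazur u att this]
    have "sgn lam *\<^sub>R \<zeta> k = sgn (nth1 x j) *\<^sub>R \<zeta> j" by (simp add: u_def)
    moreover have "sgn (nth1 x j) = 1 \<or> sgn (nth1 x j) = - 1"
      using j by (auto simp: sgn_real_def)
    ultimately have "\<zeta> j = \<zeta> k \<or> \<zeta> j = - \<zeta> k"
      using sgn_lam by (metis minus_minus scaleR_minus1_left scaleR_one)
    moreover have "\<zeta> j \<noteq> \<zeta> k"
      using mazur that by (auto simp: mazur_sequence_def inj_eq)
    ultimately show False using no_antipode that by blast
  qed
  then have x: "x = nth1 x k *\<^sub>R unit1 k"
    by (intro ell1_eqI) simp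
  then have "nth1 x k *\<^sub>R \<zeta> k = ((\<bar>lam\<bar> - \<alpha>) * sgn lam) *\<^sub>R \<zeta> k"
    using B mazur_operator_scaleR_unit1 by (metis u_def scaleR_scaleR)
  then have "nth1 x k = (\<bar>lam\<bar> - \<alpha>) * sgn lam"
    using nz by simp
  then show ?thesis
    using False assms(1) by (subst x) (simp add: shrunk_unit_eq_soft_threshold mult.commute)
qed

text \<open>
  The antipodal members \<open>\<zeta> k\<close> and \<open>\<zeta> l\<close> contribute with opposite signs, so mass \<open>a\<close> at \<open>k\<close> and
  \<open>b\<close> at \<open>l\<close> has image \<open>(a - b) *\<^sub>R \<zeta> k\<close>; with coefficients of opposite signs its norm is
  \<open>\<bar>a - b\<bar>\<close>, independent of the split.
\<close>

lemma is_minimizer_antipodal_split: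
  assumes "0 \<le> \<alpha>" "\<alpha> < \<bar>lam\<bar>" and antipode: "\<zeta> k = - \<zeta> l"
    and diff: "a - b = sgn lam * (\<bar>lam\<bar> - \<alpha>)" and signs: "a * b \<le> 0" and "b \<noteq> 0"
  shows "is_minimizer (tikhonov (mazur_operator \<zeta>) (lam *\<^sub>R \<zeta> k) \<alpha>) (a *\<^sub>R unit1 k + b *\<^sub>R unit1 l)"
    and "a *\<^sub>R unit1 k + b *\<^sub>R unit1 l \<noteq> shrunk_unit \<alpha> lam k"
proof -
  have "\<zeta> k \<noteq> \<zeta> l"
  proof
    assume "\<zeta> k = \<zeta> l"
    then have "2 *\<^sub>R \<zeta> k = 0" using antipode by (metis add.right_inverse scaleR_2)
    then show False using norm_mazur_sequence[OF mazur, of k] by auto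
  qed
  then have "k \<noteq> l" by auto
  have "\<zeta> l = - \<zeta> k" using antipode by simp
  then have "mazur_operator \<zeta> (a *\<^sub>R unit1 k + b *\<^sub>R unit1 l) = (a - b) *\<^sub>R \<zeta> k"
    by (simp add: mazur_operator_add[OF mazur] scaleR_left_diff_distrib)
  moreover have "norm (a *\<^sub>R unit1 k + b *\<^sub>R unit1 l) = \<bar>a - b\<bar>"
    using norm_unit1_combination[OF \<open>k \<noteq> l\<close>] signs by (auto simp: mult_le_0_iff)
  moreover have "\<bar>a - b\<bar> = \<bar>lam\<bar> - \<alpha>"
    using diff assms(1,2) by (auto simp: abs_mult sgn_real_def)
  ultimately show "is_minimizer (tikhonov (mazur_operator \<zeta>) (lam *\<^sub>R \<zeta> k) \<alpha>)
      (a *\<^sub>R unit1 k + b *\<^sub>R unit1 l)"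
    using assms(1,2) diff by (intro is_minimizer_scaled_memberI) simp_all
  have "nth1 (a *\<^sub>R unit1 k + b *\<^sub>R unit1 l) l \<noteq> nth1 (shrunk_unit \<alpha> lam k) l"
    using \<open>k \<noteq> l\<close> \<open>b \<noteq> 0\<close> assms(1) by (simp add: shrunk_unit_eq_soft_threshold)
  then show "a *\<^sub>R unit1 k + b *\<^sub>R unit1 l \<noteq> shrunk_unit \<alpha> lam k" by metis
qed

end

section \<open>The characterization of minimizers\<close>

theorem theorem3p3:
  fixes \<zeta> :: "nat \<Rightarrow> ell2"
  assumes "mazur_sequence \<zeta>"
  shows
    "(\<forall>y. (\<forall>\<alpha>\<ge>0. \<exists>x. is_minimizer (tikhonov (mazur_operator \<zeta>) y \<alpha>) x)
            \<longleftrightarrow> (\<exists>lam k. y = lam *\<^sub>R \<zeta> k)) \<and>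
     (\<forall>y \<alpha>. 0 < \<alpha> \<and> \<alpha> < norm y \<longrightarrow>
        ((\<exists>x. is_minimizer (tikhonov (mazur_operator \<zeta>) y \<alpha>) x)
            \<longleftrightarrow> (\<exists>lam k. y = lam *\<^sub>R \<zeta> k))) \<and>
     (\<forall>y \<alpha> lam k. 0 \<le> \<alpha> \<and> y = lam *\<^sub>R \<zeta> k \<longrightarrow>
        is_minimizer (tikhonov (mazur_operator \<zeta>) y \<alpha>) (shrunk_unit \<alpha> lam k) \<and>
        (0 < \<alpha> \<and> (\<forall>l. l \<noteq> k \<longrightarrow> \<zeta> l \<noteq> - \<zeta> k) \<longrightarrow>
           (\<exists>!x. is_minimizer (tikhonov (mazur_operator \<zeta>) y \<alpha>) x)) \<and>
        (\<forall>l. \<zeta> k = - \<zeta> l \<longrightarrow>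
           (lam > \<alpha> \<longrightarrow> (\<forall>\<gamma>\<in>{\<alpha> - lam<..<0}.
              is_minimizer (tikhonov (mazur_operator \<zeta>) y \<alpha>)
                ((\<gamma> + lam - \<alpha>) *\<^sub>R unit1 k + \<gamma> *\<^sub>R unit1 l) \<and>
              (\<gamma> + lam - \<alpha>) *\<^sub>R unit1 k + \<gamma> *\<^sub>R unit1 l \<noteq> shrunk_unit \<alpha> lam k)) \<and>
           (lam < - \<alpha> \<longrightarrow> (\<forall>\<gamma>\<in>{0<..<- \<alpha> - lam}.
              is_minimizer (tikhonov (mazur_operator \<zeta>) y \<alpha>)
                ((\<gamma> + lam + \<alpha>) *\<^sub>R unit1 k + \<gamma> *\<^sub>R unit1 l) \<and>
              (\<gamma> + lam + \<alpha>) *\<^sub>R unit1 k + \<gamma> *\<^sub>R unit1 l \<noteq> shrunk_unit \<alpha> lam k))))"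
proof (intro conjI allI impI ballI)
  fix y :: ell2
  show "(\<forall>\<alpha>\<ge>0. \<exists>x. is_minimizer (tikhonov (mazur_operator \<zeta>) y \<alpha>) x)
      \<longleftrightarrow> (\<exists>lam k. y = lam *\<^sub>R \<zeta> k)"
  proof
    assume ex: "\<forall>\<alpha>\<ge>0. \<exists>x. is_minimizer (tikhonov (mazur_operator \<zeta>) y \<alpha>) x"
    show "\<exists>lam k. y = lam *\<^sub>R \<zeta> k"
    proof (cases "y = 0")
      case True
      then have "y = 0 *\<^sub>R \<zeta> 0" by simp
      then show ?thesis by blast
    next
      case False
      \<comment> \<open>Any parameter strictly between \<open>0\<close> and \<open>norm y\<close> decides the question.\<close>
      obtain x where "is_minimizer (tikhonov (mazur_operator \<zeta>) y (norm y / 2)) x"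
        using ex[rule_format, of "norm y / 2"] by auto
      then show ?thesis
        using False multiple_of_member_if_minimizer[OF assms, of "norm y / 2" y x] by simp
    qed
  next
    assume "\<exists>lam k. y = lam *\<^sub>R \<zeta> k"
    then show "\<forall>\<alpha>\<ge>0. \<exists>x. is_minimizer (tikhonov (mazur_operator \<zeta>) y \<alpha>) x"
      using is_minimizer_shrunk_unit[OF assms] by blast
  qed
next
  fix y :: ell2 and \<alpha> :: real
  assume "0 < \<alpha> \<and> \<alpha> < norm y"
  then have "0 < \<alpha>" "0 \<le> \<alpha>" "\<alpha> < norm y" by simp_all
  then show "(\<exists>x. is_minimizer (tikhonov (mazur_operator \<zeta>) y \<alpha>) x)
      \<longleftrightarrow> (\<exists>lam k. y = lam *\<^sub>R \<zeta> k)"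
    using multiple_of_member_if_minimizer[OF assms] is_minimizer_shrunk_unit[OF assms] by blast
next
  fix y :: ell2 and \<alpha> lam :: real and k :: nat
  assume y: "0 \<le> \<alpha> \<and> y = lam *\<^sub>R \<zeta> k"
  then show "is_minimizer (tikhonov (mazur_operator \<zeta>) y \<alpha>) (shrunk_unit \<alpha> lam k)"
    using is_minimizer_shrunk_unit[OF assms] by blast
  assume "0 < \<alpha> \<and> (\<forall>l. l \<noteq> k \<longrightarrow> \<zeta> l \<noteq> - \<zeta> k)"
  with y show "\<exists>!x. is_minimizer (tikhonov (mazur_operator \<zeta>) y \<alpha>) x"
    using is_minimizer_shrunk_unit[OF assms] minimizer_eq_shrunk_unit[OF assms] by blast
next
  fix y :: ell2 and \<alpha> lam \<gamma> :: real and k l :: nat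
  assume y: "0 \<le> \<alpha> \<and> y = lam *\<^sub>R \<zeta> k" and antipode: "\<zeta> k = - \<zeta> l"
    and "\<alpha> < lam" "\<gamma> \<in> {\<alpha> - lam<..<0}"
  then have "\<alpha> < \<bar>lam\<bar>" "(\<gamma> + lam - \<alpha>) - \<gamma> = sgn lam * (\<bar>lam\<bar> - \<alpha>)"
    "(\<gamma> + lam - \<alpha>) * \<gamma> \<le> 0" "\<gamma> \<noteq> 0"
    by (auto simp: sgn_real_def mult_le_0_iff)
  note split = is_minimizer_antipodal_split[OF assms _ this(1) antipode this(2-4)]
  show "is_minimizer (tikhonov (mazur_operator \<zeta>) y \<alpha>) ((\<gamma> + lam - \<alpha>) *\<^sub>R unit1 k + \<gamma> *\<^sub>R unit1 l)"
    "(\<gamma> + lam - \<alpha>) *\<^sub>R unit1 k + \<gamma> *\<^sub>R unit1 l \<noteq> shrunk_unit \<alpha> lam k"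
    using split y by auto
next
  fix y :: ell2 and \<alpha> lam \<gamma> :: real and k l :: nat
  assume y: "0 \<le> \<alpha> \<and> y = lam *\<^sub>R \<zeta> k" and antipode: "\<zeta> k = - \<zeta> l"
    and "lam < - \<alpha>" "\<gamma> \<in> {0<..<- \<alpha> - lam}"
  then have "\<alpha> < \<bar>lam\<bar>" "(\<gamma> + lam + \<alpha>) - \<gamma> = sgn lam * (\<bar>lam\<bar> - \<alpha>)"
    "(\<gamma> + lam + \<alpha>) * \<gamma> \<le> 0" "\<gamma> \<noteq> 0"
    by (auto simp: sgn_real_def mult_le_0_iff)
  note split = is_minimizer_antipodal_split[OF assms _ this(1) antipode this(2-4)]
  show "is_minimizer (tikhonov (mazur_operator \<zeta>) y \<alpha>) ((\<gamma> + lam + \<alpha>) *\<^sub>R unit1 k + \<gamma> *\<^sub>R unit1 l)"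
    "(\<gamma> + lam + \<alpha>) *\<^sub>R unit1 k + \<gamma> *\<^sub>R unit1 l \<noteq> shrunk_unit \<alpha> lam k"
    using split y by auto
qed

end
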